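(* Let $\mathcal H$ be a separable Hilbert space and let $\mathbf C\in\mathcal B(\mathcal H)$ be accretive. Then $\mathbf C$ is hypocoercive (equivalently, the $C_0$-semigroup $(e^{-\mathbf Ct})_{t\ge0}$ is uniformly exponentially stable) if and only if $\mathbf C$ has a hypocoercivity index $m_{HC}\in\mathbb N_0$, i.e. if and only if there exist $m\in\mathbb N_0$ and $\kappa>0$ such that $$\sum_{j=0}^m(\mathbf C^* )^j\mathbf C_H\mathbf C^j\ge\kappa\mathbf I.$$
   Context: $\mathcal B(\mathcal H)$ is the space of bounded linear operators on $\mathcal H$. $\mathbf C_H=(\mathbf C+\mathbf C^* )/2$. $\mathbf C$ is accretive if $\operatorname{Re}\langle\mathbf Cx,x\rangle\ge0$ for all $x\in\mathcal H$. The hypocoercivity index of an accretive $\mathbf C\in\mathcal B(\mathcal H)$ is the smallest integer $m\in\mathbb N_0$ (if it exists) such that $\sum_{j=0}^m(\mathbf C^* )^j\mathbf C_H\mathbf C^j\ge\kappa\mathbf I$ for some $\kappa>0$. $\mathbf C\in\mathcal B(\mathcal H)$ is hypocoercive if there exist $M<\infty$ and $\lambda>0$ with $\|e^{-\mathbf Ct}\|\le Me^{-\lambda t}$ for all $t\ge0$ (uniform exponential stability). *)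

theory Defs
  imports "HOL-Analysis.Analysis"
begin

text \<open>
  A complex inner product space is built on top of the library's \<^class>\<open>real_inner\<close> by adding a
  complex scalar multiplication compatible with the real one and a sesquilinear form, linear in the
  first argument, whose real part is the real inner product. Hence norm and topology are those of
  the sesquilinear form, and positive definiteness is inherited from the real inner product.
\<close>

class complex_inner = real_inner +
  fixes scaleC :: "complex \<Rightarrow> 'a \<Rightarrow> 'a"  (infixr \<open>*\<^sub>C\<close> 75)
    and cinner :: "'a \<Rightarrow> 'a \<Rightarrow> complex"
  assumes scaleC_add_right: "c *\<^sub>C (x + y) = c *\<^sub>C x + c *\<^sub>C y"
    and scaleC_add_left: "(c + d) *\<^sub>C x = c *\<^sub>C x + d *\<^sub>C x"
    and scaleC_scaleC: "c *\<^sub>C d *\<^sub>C x = (c * d) *\<^sub>C x"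
    and scaleC_of_real: "complex_of_real r *\<^sub>C x = r *\<^sub>R x"
    and cinner_commute: "cinner x y = cnj (cinner y x)"
    and cinner_add_left: "cinner (x + y) z = cinner x z + cinner y z"
    and cinner_scaleC_left: "cinner (c *\<^sub>C x) y = c * cinner x y"
    and inner_eq_Re_cinner: "inner x y = Re (cinner x y)"

class chilbert_space = complex_inner + complete_space

instance chilbert_space \<subseteq> banach ..

instantiation complex :: chilbert_space
begin

definition scaleC_complex :: "complex \<Rightarrow> complex \<Rightarrow> complex"
  where "scaleC_complex c x = c * x"

definition cinner_complex :: "complex \<Rightarrow> complex \<Rightarrow> complex"
  where "cinner_complex x y = x * cnj y"

instance
  by standard
    (simp_all add: scaleC_complex_def cinner_complex_def algebra_simps scaleR_conv_of_real
      inner_complex_def)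

end

text \<open>
  Bounded operators on a complex Hilbert space are the complex linear elements of the library's
  type of bounded real linear maps; the operator norm is the same.
\<close>

definition clinear_op :: "('a::complex_inner \<Rightarrow>\<^sub>L 'a) \<Rightarrow> bool"
  where "clinear_op A \<longleftrightarrow> (\<forall>c x. blinfun_apply A (c *\<^sub>C x) = c *\<^sub>C blinfun_apply A x)"

text \<open>
  The description below is meaningful for complex linear operators on a Hilbert space, where
  existence and uniqueness of the adjoint follow from the Riesz representation theorem.
\<close>

definition op_adjoint :: "('a::complex_inner \<Rightarrow>\<^sub>L 'a) \<Rightarrow> 'a \<Rightarrow>\<^sub>L 'a"
  where "op_adjoint A =
    (THE B. \<forall>x y. cinner (blinfun_apply A x) y = cinner x (blinfun_apply B y))"

definition hermitian_part :: "('a::complex_inner \<Rightarrow>\<^sub>L 'a) \<Rightarrow> 'a \<Rightarrow>\<^sub>L 'a"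
  where "hermitian_part A = (1 / 2) *\<^sub>R (A + op_adjoint A)"

text \<open>
  Bounded linear maps are not an instance of the library's algebra classes, so powers and the
  exponential series have to be introduced separately.
\<close>

primrec op_power :: "('a::real_normed_vector \<Rightarrow>\<^sub>L 'a) \<Rightarrow> nat \<Rightarrow> 'a \<Rightarrow>\<^sub>L 'a"
  where
    "op_power A 0 = id_blinfun"
  | "op_power A (Suc n) = A o\<^sub>L op_power A n"

definition op_exp :: "('a::banach \<Rightarrow>\<^sub>L 'a) \<Rightarrow> 'a \<Rightarrow>\<^sub>L 'a"
  where "op_exp A = (\<Sum>n. (1 / fact n) *\<^sub>R op_power A n)"

text \<open>
  The Loewner order; membership in the nonnegative reals contains the requirement that the
  quadratic form of the difference is real-valued.
\<close>

definition loewner_le :: "('a::complex_inner \<Rightarrow>\<^sub>L 'a) \<Rightarrow> ('a \<Rightarrow>\<^sub>L 'a) \<Rightarrow> bool"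
  where "loewner_le A B \<longleftrightarrow> (\<forall>x. cinner (blinfun_apply (B - A) x) x \<in> \<real>\<^sub>\<ge>\<^sub>0)"

definition accretive :: "('a::complex_inner \<Rightarrow>\<^sub>L 'a) \<Rightarrow> bool"
  where "accretive C \<longleftrightarrow> (\<forall>x. Re (cinner (blinfun_apply C x) x) \<ge> 0)"

definition hypocoercivity_sum :: "('a::complex_inner \<Rightarrow>\<^sub>L 'a) \<Rightarrow> nat \<Rightarrow> 'a \<Rightarrow>\<^sub>L 'a"
  where "hypocoercivity_sum C m =
    (\<Sum>j\<le>m. op_power (op_adjoint C) j o\<^sub>L hermitian_part C o\<^sub>L op_power C j)"

definition has_hypocoercivity_index :: "('a::complex_inner \<Rightarrow>\<^sub>L 'a) \<Rightarrow> nat \<Rightarrow> bool"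
  where "has_hypocoercivity_index C m \<longleftrightarrow>
    (\<exists>\<kappa>>0. loewner_le (\<kappa> *\<^sub>R id_blinfun) (hypocoercivity_sum C m)) \<and>
    (\<forall>k. (\<exists>\<kappa>>0. loewner_le (\<kappa> *\<^sub>R id_blinfun) (hypocoercivity_sum C k)) \<longrightarrow> m \<le> k)"

definition uniformly_exponentially_stable :: "(real \<Rightarrow> 'a::real_normed_vector \<Rightarrow>\<^sub>L 'a) \<Rightarrow> bool"
  where "uniformly_exponentially_stable T \<longleftrightarrow>
    (\<exists>M. \<exists>\<omega>>0. \<forall>t\<ge>0. norm (T t) \<le> M * exp (- \<omega> * t))"

definition hypocoercive :: "('a::chilbert_space \<Rightarrow>\<^sub>L 'a) \<Rightarrow> bool"
  where "hypocoercive C \<longleftrightarrow> uniformly_exponentially_stable (\<lambda>t. op_exp (- (t *\<^sub>R C)))"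

end

theory Submission
  imports Defs
begin

text \<open>
  Write \<open>q x = Re \<langle>C x, x\<rangle> \<ge> 0\<close> for the dissipation and \<open>T t = exp (- t C)\<close>. Moving the powers of the
  adjoint to the other side, the hypocoercivity condition reads
  \<open>\<kappa> * \<parallel>x\<parallel>\<^sup>2 \<le> (\<Sum>j\<le>m. q (C\<^sup>j x))\<close> for all \<open>x\<close>, so the theorem compares the growth of \<open>T\<close> with the
  dissipation along the Krylov vectors \<open>C\<^sup>j x\<close>. The link between the two is the energy identity
  \<open>d/dt \<parallel>T t x\<parallel>\<^sup>2 = - 2 q (T t x)\<close>, together with the fact that \<open>q\<close>, being a nonnegative quadratic
  form, satisfies \<open>q (x + y) \<le> 2 q x + 2 q y\<close>.

  Stability implies coercivity. If \<open>T t\<close> halves all norms, the mean value theorem applied to the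
  energy gives a time \<open>s < t\<close> with \<open>q (T s x) \<ge> c \<parallel>x\<parallel>\<^sup>2\<close>, where \<open>c\<close> is independent of \<open>x\<close>. The
  exponential series converges in operator norm, uniformly for \<open>s\<close> in \<open>{0..t}\<close>; so \<open>T s x\<close> can be
  replaced, at the cost of half of \<open>c\<close>, by a Taylor polynomial of a fixed degree \<open>m\<close>, whose
  dissipation is at most a constant times \<open>\<Sum>j\<le>m. q (C\<^sup>j x)\<close>
  (\<open>coercive_if_exponentially_stable\<close>).

  Coercivity implies stability. By the semigroup law it is enough that \<open>T n\<close> is a strict contraction
  for one \<open>n\<close>. Otherwise there are unit vectors \<open>y n\<close> with \<open>\<parallel>T n (y n)\<parallel> \<longlonglongrightarrow> 1\<close>, and hence every fixed
  \<open>T t\<close> asymptotically preserves the norms of the \<open>y n\<close>. The bounded sequences with this property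
  are stable under each \<open>T h\<close>, under linear combinations and under uniform approximation,
  therefore also under \<open>C\<close>, the operator norm limit of \<open>(I - T h) / h\<close>
  (\<open>asymptotically_isometric_generator\<close>); and the dissipation tends to zero along them
  (\<open>asymptotically_isometric_dissipation\<close>). So \<open>q (C\<^sup>j (y n)) \<longlonglongrightarrow> 0\<close> for every \<open>j\<close>, which contradicts
  coercivity.
\<close>

section \<open>Adjoints on a complex Hilbert space\<close>

text \<open>
  The representing vector minimises \<open>J x = \<parallel>x\<parallel>\<^sup>2 - 2 f x\<close>: the parallelogram law makes every minimising
  sequence Cauchy, and the first-order condition at the minimum is the claim.
\<close>

lemma riesz_representation:
  fixes f :: "'a::{real_inner,complete_space} \<Rightarrow> real"
  assumes "bounded_linear f"
  obtains z where "\<And>x. f x = inner z x"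
proof -
  interpret f: bounded_linear f by fact
  define J where "J x = (norm x)\<^sup>2 - 2 * f x" for x
  obtain K where K: "\<And>x. \<bar>f x\<bar> \<le> norm x * K"
    using f.bounded by (auto simp: real_norm_def)
  have J_ge: "- K\<^sup>2 \<le> J x" for x
  proof -
    have "0 \<le> (norm x - K)\<^sup>2" by simp
    also have "\<dots> = (norm x)\<^sup>2 - 2 * (norm x * K) + K\<^sup>2"
      by (simp add: power2_eq_square algebra_simps)
    finally show ?thesis using K[of x] by (simp add: J_def)
  qed
  define m where "m = (INF x. J x)"
  have bdd: "bdd_below (range J)" using J_ge by (auto intro!: bdd_belowI)
  have m_le: "m \<le> J x" for x unfolding m_def by (rule cINF_lower[OF bdd]) simp
  have "\<exists>x. J x < m + 1 / Suc n" for n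
  proof -
    have "\<exists>y\<in>range J. y < m + 1 / Suc n"
      by (rule cInf_lessD) (auto simp: m_def)
    then show ?thesis by auto
  qed
  then obtain u where u: "\<And>n. J (u n) < m + 1 / Suc n" by metis
  have par: "(norm (x - y))\<^sup>2 = 2 * J x + 2 * J y - 4 * J ((1/2) *\<^sub>R (x + y))" for x y
    unfolding J_def power2_norm_eq_inner
    by (simp add: f.scaleR f.add inner_simps algebra_simps inner_commute)
  have small: "(norm (u i - u j))\<^sup>2 < 2 / Suc i + 2 / Suc j" for i j
    using par[of "u i" "u j"] u[of i] u[of j] m_le[of "(1/2) *\<^sub>R (u i + u j)"] by simp
  have "Cauchy u"
  proof (rule CauchyI)
    fix e :: real assume "0 < e"
    then have "0 < e\<^sup>2 / 4" by simp
    then obtain N where N: "inverse (real (Suc N)) < e\<^sup>2 / 4"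
      using reals_Archimedean by blast
    have "norm (u i - u j) < e" if "i \<ge> N" "j \<ge> N" for i j
    proof -
      have "1 / Suc i \<le> 1 / Suc N" "1 / Suc j \<le> 1 / Suc N"
        using that by (auto intro!: divide_left_mono)
      then have "(norm (u i - u j))\<^sup>2 < e\<^sup>2"
        using small[of i j] N by (simp add: inverse_eq_divide)
      then show ?thesis using \<open>0 < e\<close> by (simp add: power_less_imp_less_base)
    qed
    then show "\<exists>M. \<forall>m\<ge>M. \<forall>n\<ge>M. norm (u m - u n) < e" by blast
  qed
  then obtain z where z: "u \<longlonglongrightarrow> z" using Cauchy_convergent convergent_def by blast
  have "(\<lambda>n. J (u n)) \<longlonglongrightarrow> J z"
    unfolding J_def by (intro tendsto_intros f.tendsto z)
  moreover have "(\<lambda>n. m + 1 / Suc n) \<longlonglongrightarrow> m + 0"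
    by (intro tendsto_intros LIMSEQ_Suc[OF lim_1_over_n])
  ultimately have "J z \<le> m + 0"
    by (rule LIMSEQ_le) (use u less_imp_le in blast)
  then have "J z \<le> m" by simp
  have "f x = inner z x" for x
  proof -
    have quad: "0 \<le> 2 * t * (inner z x - f x) + t\<^sup>2 * (norm x)\<^sup>2" for t
    proof -
      have "J (z + t *\<^sub>R x) = J z + 2 * t * (inner z x - f x) + t\<^sup>2 * (norm x)\<^sup>2"
        unfolding J_def power2_norm_eq_inner
        by (simp add: f.scaleR f.add inner_simps algebra_simps inner_commute power2_eq_square)
      then show ?thesis using \<open>J z \<le> m\<close> m_le[of "z + t *\<^sub>R x"] by linarith
    qed
    \<comment> \<open>The quadratic polynomial in \<open>t\<close> is tested near its minimum; adding 1 to its leading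
      coefficient covers \<open>x = 0\<close>.\<close>
    define d where "d = inner z x - f x"
    define s where "s = 1 + (norm x)\<^sup>2"
    have "s > 0" by (simp add: s_def add_pos_nonneg)
    have "0 \<le> s * s * (2 * (- d / s) * d + (- d / s)\<^sup>2 * (norm x)\<^sup>2)"
      using quad[of "- d / s"] \<open>s > 0\<close> by (simp add: d_def)
    also have "\<dots> = - d\<^sup>2 * (s + 1)"
    proof -
      have n: "(norm x)\<^sup>2 = s - 1" by (simp add: s_def)
      show ?thesis unfolding n using \<open>s > 0\<close> by (simp add: field_simps power2_eq_square)
    qed
    finally have "d\<^sup>2 * (s + 1) \<le> 0" by simp
    then have "d = 0" using \<open>s > 0\<close> by (simp add: mult_le_0_iff)
    then show ?thesis by (simp add: d_def)
  qed
  then show ?thesis using that by blast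
qed

lemma cinner_scaleR_left: "cinner (r *\<^sub>R x) y = r * cinner x y"
  by (metis cinner_scaleC_left scaleC_of_real)

lemma Im_cinner: "Im (cinner x y) = - inner (\<i> *\<^sub>C x) y"
  by (simp add: inner_eq_Re_cinner cinner_scaleC_left)

lemma adjoint_exists:
  fixes A :: "'a::{real_inner,complete_space} \<Rightarrow>\<^sub>L 'a"
  shows "\<exists>B :: 'a \<Rightarrow>\<^sub>L 'a. \<forall>x y. inner (A x) y = inner x (B y)"
proof -
  have "\<exists>z. \<forall>x. inner (A x) y = inner x z" for y
  proof -
    have "bounded_linear (\<lambda>x. inner (A x) y)"
      by (intro bounded_linear_intros)
    from riesz_representation[OF this] show ?thesis
      by (metis inner_commute)
  qed
  then obtain g where g: "\<And>x y. inner (A x) y = inner x (g y)" by metis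
  have "bounded_linear g"
  proof (rule bounded_linear_intro)
    show "g (x + y) = g x + g y" for x y
      by (rule vector_eq_ldot[THEN iffD1], rule allI) (simp add: inner_add_right flip: g)
    show "g (r *\<^sub>R x) = r *\<^sub>R g x" for r x
      by (rule vector_eq_ldot[THEN iffD1], rule allI) (simp flip: g)
    show "norm (g x) \<le> norm x * norm A" for x
    proof (cases "g x = 0")
      case False
      have "norm (g x) * norm (g x) = inner (A (g x)) x"
        by (simp add: g flip: power2_norm_eq_inner power2_eq_square)
      also have "\<dots> \<le> norm (A (g x)) * norm x" by (rule norm_cauchy_schwarz)
      also have "\<dots> \<le> (norm A * norm (g x)) * norm x"
        by (intro mult_right_mono norm_blinfun) simp
      finally have "norm (g x) * norm (g x) \<le> (norm x * norm A) * norm (g x)"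
        by (simp add: mult_ac)
      with False show ?thesis by simp
    qed simp
  qed
  then show ?thesis
    using g by (intro exI[of _ "Blinfun g"]) (simp add: bounded_linear_Blinfun_apply)
qed

text \<open>
  Complex linearity of \<open>A\<close> makes its real adjoint the complex one: the imaginary part of the
  sesquilinear form is the real part after multiplication by \<open>\<i>\<close>. This is where the
  definite description in \<^const>\<open>op_adjoint\<close> is shown to be meaningful.
\<close>

lemma cinner_op_adjoint:
  fixes A :: "'a::chilbert_space \<Rightarrow>\<^sub>L 'a"
  assumes "clinear_op A"
  shows "cinner (A x) y = cinner x (op_adjoint A y)"
proof -
  obtain B :: "'a \<Rightarrow>\<^sub>L 'a" where B: "\<And>x y. inner (A x) y = inner x (B y)"
    using adjoint_exists by blast
  have Im: "Im (cinner (A x) y) = Im (cinner x (B y))" for x y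
    using assms by (simp add: Im_cinner clinear_op_def flip: B)
  have adj: "cinner (A x) y = cinner x (B y)" for x y
    using B Im by (simp add: complex_eq_iff flip: inner_eq_Re_cinner)
  have "op_adjoint A = B"
    unfolding op_adjoint_def
  proof (rule the_equality)
    fix B' :: "'a \<Rightarrow>\<^sub>L 'a"
    assume "\<forall>x y. cinner (A x) y = cinner x (B' y)"
    then have "\<forall>x. inner x (B' y) = inner x (B y)" for y
      by (simp add: inner_eq_Re_cinner flip: adj)
    then show "B' = B"
      unfolding vector_eq_ldot by (rule blinfun_eqI)
  qed (use adj in blast)
  then show ?thesis using adj by simp
qed

lemma cinner_op_adjoint_left:
  fixes A :: "'a::chilbert_space \<Rightarrow>\<^sub>L 'a"
  assumes "clinear_op A"
  shows "cinner (op_adjoint A x) y = cinner x (A y)"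
proof -
  have "cinner (op_adjoint A x) y = cnj (cinner (A y) x)"
    unfolding cinner_op_adjoint[OF assms] by (rule cinner_commute)
  also have "\<dots> = cinner x (A y)" by (rule cinner_commute[symmetric])
  finally show ?thesis .
qed

lemma cinner_op_power_adjoint:
  fixes A :: "'a::chilbert_space \<Rightarrow>\<^sub>L 'a"
  assumes "clinear_op A"
  shows "cinner (op_power (op_adjoint A) j x) y = cinner x (op_power A j y)"
proof (induction j arbitrary: y)
  case (Suc j)
  have comm: "A (op_power A j y) = op_power A j (A y)" for y
    by (induction j arbitrary: y) auto
  show ?case by (simp add: cinner_op_adjoint_left[OF assms] Suc.IH comm)
qed simp

lemma cinner_hermitian_part:
  fixes A :: "'a::chilbert_space \<Rightarrow>\<^sub>L 'a"
  assumes "clinear_op A"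
  shows "cinner (hermitian_part A x) x = inner (A x) x"
proof -
  have "cinner (hermitian_part A x) x
      = complex_of_real (1 / 2) * (cinner (A x) x + cinner (op_adjoint A x) x)"
    unfolding hermitian_part_def
    by (simp only: blinfun.scaleR_left blinfun.add_left cinner_scaleR_left cinner_add_left)
  also have "cinner (op_adjoint A x) x = cnj (cinner (A x) x)"
    unfolding cinner_op_adjoint_left[OF assms] by (rule cinner_commute)
  also have "complex_of_real (1 / 2) * (cinner (A x) x + cnj (cinner (A x) x)) = inner (A x) x"
    unfolding inner_eq_Re_cinner complex_add_cnj by simp
  finally show ?thesis .
qed

lemma cinner_hypocoercivity_sum:
  fixes C :: "'a::chilbert_space \<Rightarrow>\<^sub>L 'a"
  assumes "clinear_op C"
  shows "cinner (hypocoercivity_sum C m x) x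
    = (\<Sum>j\<le>m. inner (C (op_power C j x)) (op_power C j x))"
proof -
  have sum: "cinner (\<Sum>j\<le>m. g j) x = (\<Sum>j\<le>m. cinner (g j) x)" for g :: "nat \<Rightarrow> 'a"
    by (induction m) (simp_all add: cinner_add_left)
  show ?thesis
    by (simp add: hypocoercivity_sum_def blinfun.sum_left sum cinner_op_power_adjoint[OF assms]
        cinner_hermitian_part[OF assms])
qed

lemma loewner_le_hypocoercivity_sum_iff:
  fixes C :: "'a::chilbert_space \<Rightarrow>\<^sub>L 'a"
  assumes "clinear_op C"
  shows "loewner_le (\<kappa> *\<^sub>R id_blinfun) (hypocoercivity_sum C m) \<longleftrightarrow>
    (\<forall>x. \<kappa> * (norm x)\<^sup>2 \<le> (\<Sum>j\<le>m. inner (C (op_power C j x)) (op_power C j x)))"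
proof -
  have "cinner ((hypocoercivity_sum C m - \<kappa> *\<^sub>R id_blinfun) x) x
      = complex_of_real ((\<Sum>j\<le>m. inner (C (op_power C j x)) (op_power C j x)) - \<kappa> * (norm x)\<^sup>2)"
    for x
  proof -
    have diff: "cinner (u - v) x = cinner u x - cinner v x" for u v :: 'a
      using cinner_add_left[of "u - v" v x] by simp
    have "Im (cinner x x) = 0"
      using arg_cong[OF cinner_commute[of x x], of Im] by simp
    then have "cinner x x = complex_of_real ((norm x)\<^sup>2)"
      by (simp add: complex_eq_iff power2_norm_eq_inner inner_eq_Re_cinner)
    then show ?thesis
      by (simp add: blinfun.bilinear_simps diff cinner_scaleR_left
          cinner_hypocoercivity_sum[OF assms])
  qed
  then show ?thesis
    unfolding loewner_le_def by (simp only: nonneg_Reals_of_real_iff) simp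
qed

section \<open>The operator exponential\<close>

lemma norm_op_power_le: "norm (op_power A n) \<le> norm A ^ n"
proof (induction n)
  case 0 show ?case by (simp add: norm_blinfun_id_le)
next
  case (Suc n)
  have "norm (op_power A (Suc n)) \<le> norm A * norm (op_power A n)"
    by (simp add: norm_blinfun_compose)
  also have "\<dots> \<le> norm A * norm A ^ n" by (intro mult_left_mono Suc) simp
  finally show ?case by simp
qed

lemma op_power_scaleR: "op_power (t *\<^sub>R A) n = t ^ n *\<^sub>R op_power A n"
  by (induction n)
    (simp_all add: bounded_bilinear.scaleR_left[OF bounded_bilinear_blinfun_compose]
      bounded_bilinear.scaleR_right[OF bounded_bilinear_blinfun_compose])

text \<open>
  The variable \<open>t\<close> is pulled out of the powers, so that the exponential appears as a power series
  in \<open>t\<close>. The uniformity serves twice: for differentiating term by term, and for Taylor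
  approximation with a degree that does not depend on the time.
\<close>

lemma op_exp_uniform_limit:
  fixes A :: "'a::banach \<Rightarrow>\<^sub>L 'a"
  shows "uniform_limit {-R..R} (\<lambda>n t. \<Sum>i<n. (t ^ i / fact i) *\<^sub>R op_power A i)
    (\<lambda>t. op_exp (t *\<^sub>R A)) sequentially"
proof -
  have "norm ((t ^ n / fact n) *\<^sub>R op_power A n) \<le> (R * norm A) ^ n /\<^sub>R fact n"
    if "t \<in> {-R..R}" for t n
  proof -
    have "norm ((t ^ n / fact n) *\<^sub>R op_power A n) = \<bar>t\<bar> ^ n * norm (op_power A n) / fact n"
      by (simp add: power_abs)
    also have "\<dots> \<le> R ^ n * norm A ^ n / fact n"
      using that by (intro divide_right_mono mult_mono power_mono norm_op_power_le) auto
    finally show ?thesis by (simp add: power_mult_distrib divide_inverse mult_ac)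
  qed
  then have "uniform_limit {-R..R} (\<lambda>n t. \<Sum>i<n. (t ^ i / fact i) *\<^sub>R op_power A i)
      (\<lambda>t. \<Sum>i. (t ^ i / fact i) *\<^sub>R op_power A i) sequentially"
    by (rule Weierstrass_m_test) (assumption, rule summable_exp_generic)
  then show ?thesis
    by (simp add: op_exp_def op_power_scaleR)
qed

lemma op_exp_has_derivative:
  fixes A :: "'a::banach \<Rightarrow>\<^sub>L 'a"
  shows "((\<lambda>t. op_exp (t *\<^sub>R A)) has_vector_derivative A o\<^sub>L op_exp (t *\<^sub>R A)) (at t)"
proof -
  define R where "R = \<bar>t\<bar> + 1"
  define S where "S = {-R<..<R}"
  have t: "t \<in> S" by (auto simp: S_def R_def)
  define f where "f n t = (t ^ n / fact n) *\<^sub>R op_power A n" for n and t :: real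
  define d where "d n t = (real n * t ^ (n - 1) / fact n) *\<^sub>R op_power A n" for n and t :: real
  \<comment> \<open>Differentiation shifts the series by one and composes it with \<open>A\<close>.\<close>
  have d_0: "d 0 t = 0" for t by (simp add: d_def)
  have d_Suc: "d (Suc n) t = A o\<^sub>L f n t" for n t
    by (simp add: d_def f_def bounded_bilinear.scaleR_right[OF bounded_bilinear_blinfun_compose]
        del: of_nat_Suc)
  have sum_d: "(\<Sum>i<Suc n. d i t) = A o\<^sub>L (\<Sum>i<n. f i t)" for n t
    by (simp only: sum.lessThan_Suc_shift d_0 d_Suc
        bounded_bilinear.sum_right[OF bounded_bilinear_blinfun_compose]) simp
  have lim: "uniform_limit S (\<lambda>n t. \<Sum>i<n. f i t) (\<lambda>t. op_exp (t *\<^sub>R A)) sequentially"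
    unfolding f_def by (rule uniform_limit_on_subset[OF op_exp_uniform_limit[where R = R]])
      (auto simp: S_def)
  have "uniform_limit S (\<lambda>n t. A o\<^sub>L (\<Sum>i<n. f i t)) (\<lambda>t. A o\<^sub>L op_exp (t *\<^sub>R A)) sequentially"
    by (rule bounded_linear.uniform_limit[OF
          bounded_bilinear.bounded_linear_right[OF bounded_bilinear_blinfun_compose] lim])
  then have lim': "uniform_limit S (\<lambda>n t. \<Sum>i<Suc n. d i t) (\<lambda>t. A o\<^sub>L op_exp (t *\<^sub>R A)) sequentially"
    by (simp only: sum_d)
  have "\<exists>g. \<forall>x\<in>S. (\<lambda>n. f n x) sums g x \<and>
      (g has_derivative (\<lambda>h. h *\<^sub>R (A o\<^sub>L op_exp (x *\<^sub>R A)))) (at x within S)"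
  proof (rule has_derivative_series)
    show "convex S" by (simp add: S_def)
    show "(f n has_derivative (\<lambda>h. h *\<^sub>R d n x)) (at x within S)" for n x
    proof -
      have "((\<lambda>t. t ^ n / fact n) has_derivative (\<lambda>h. h * (real n * x ^ (n - 1) / fact n)))
          (at x within S)"
        by (auto intro!: derivative_eq_intros simp: mult_ac)
      from has_derivative_scaleR_left[OF this, of "op_power A n"] show ?thesis
        unfolding f_def[abs_def] d_def scaleR_scaleR .
    qed
    show "t \<in> S" by fact
    show "(\<lambda>n. f n t) sums op_exp (t *\<^sub>R A)"
      unfolding sums_def using tendsto_uniform_limitI[OF lim t] .
    fix e :: real assume "e > 0"
    from uniform_limitD[OF lim' this] obtain N where
      N: "\<And>n x. n \<ge> N \<Longrightarrow> x \<in> S \<Longrightarrow> dist (\<Sum>i<Suc n. d i x) (A o\<^sub>L op_exp (x *\<^sub>R A)) < e"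
      unfolding eventually_sequentially by blast
    have "norm ((\<Sum>i<n. h *\<^sub>R d i x) - h *\<^sub>R (A o\<^sub>L op_exp (x *\<^sub>R A))) \<le> e * norm h"
      if n: "n \<ge> Suc N" and x: "x \<in> S" for n x and h :: real
    proof -
      obtain k where k: "n = Suc k" "k \<ge> N" using n by (cases n) auto
      have "norm ((\<Sum>i<n. h *\<^sub>R d i x) - h *\<^sub>R (A o\<^sub>L op_exp (x *\<^sub>R A)))
          = \<bar>h\<bar> * dist (\<Sum>i<Suc k. d i x) (A o\<^sub>L op_exp (x *\<^sub>R A))"
        by (simp add: k dist_norm del: sum.lessThan_Suc
            flip: scaleR_sum_right scaleR_diff_right)
      also have "\<dots> \<le> \<bar>h\<bar> * e"
        using N[OF k(2) x] by (intro mult_left_mono) auto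
      finally show ?thesis by (simp add: mult.commute)
    qed
    then show "\<forall>\<^sub>F n in sequentially. \<forall>x\<in>S. \<forall>h. norm ((\<Sum>i<n. h *\<^sub>R d i x)
        - h *\<^sub>R (A o\<^sub>L op_exp (x *\<^sub>R A))) \<le> e * norm h"
      unfolding eventually_sequentially by blast
  qed
  then obtain g where g: "\<And>x. x \<in> S \<Longrightarrow> (\<lambda>n. f n x) sums g x"
    "(g has_derivative (\<lambda>h. h *\<^sub>R (A o\<^sub>L op_exp (t *\<^sub>R A)))) (at t within S)"
    using t by blast
  have "g x = op_exp (x *\<^sub>R A)" if "x \<in> S" for x
    using g(1)[OF that] tendsto_uniform_limitI[OF lim that]
    unfolding sums_def by (rule LIMSEQ_unique)
  then have "((\<lambda>t. op_exp (t *\<^sub>R A)) has_derivative (\<lambda>h. h *\<^sub>R (A o\<^sub>L op_exp (t *\<^sub>R A)))) (at t within S)"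
    by (intro has_derivative_transform[OF t _ g(2)]) simp
  moreover have "at t within S = at t"
    using t by (rule at_within_open) (simp add: S_def)
  ultimately show ?thesis
    unfolding has_vector_derivative_def by (simp only:)
qed

lemma op_exp_0: "op_exp (0 :: 'a::banach \<Rightarrow>\<^sub>L 'a) = id_blinfun"
proof -
  have "(\<lambda>n. (1 / fact n) *\<^sub>R op_power (0 :: 'a \<Rightarrow>\<^sub>L 'a) n) sums (\<Sum>n\<in>{0}. (1 / fact n) *\<^sub>R op_power (0 :: 'a \<Rightarrow>\<^sub>L 'a) n)"
  proof (rule sums_finite)
    fix n :: nat assume "n \<notin> {0}"
    then show "(1 / fact n) *\<^sub>R op_power (0 :: 'a \<Rightarrow>\<^sub>L 'a) n = 0"
      by (cases n) simp_all
  qed simp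
  then show ?thesis by (simp add: op_exp_def sums_iff)
qed


section \<open>The contraction semigroup of an accretive operator\<close>

locale accretive_operator =
  fixes C :: "'a::{real_inner,banach} \<Rightarrow>\<^sub>L 'a"
  assumes accretive: "0 \<le> inner (C x) x"
begin

definition dissipation :: "'a \<Rightarrow> real"
  where "dissipation x = inner (C x) x"

definition evolution :: "real \<Rightarrow> 'a \<Rightarrow>\<^sub>L 'a"
  where "evolution t = op_exp (- (t *\<^sub>R C))"

lemma dissipation_nonneg: "0 \<le> dissipation x"
  unfolding dissipation_def by (rule accretive)

lemma dissipation_scaleR: "dissipation (r *\<^sub>R x) = r\<^sup>2 * dissipation x"
  by (simp add: dissipation_def blinfun.scaleR_right power2_eq_square)

lemma dissipation_le: "dissipation x \<le> norm C * (norm x)\<^sup>2"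
proof -
  have "dissipation x \<le> norm (C x) * norm x"
    unfolding dissipation_def by (rule norm_cauchy_schwarz)
  also have "\<dots> \<le> (norm C * norm x) * norm x"
    by (intro mult_right_mono norm_blinfun) simp
  finally show ?thesis by (simp add: power2_eq_square mult.assoc)
qed

text \<open>
  The parallelogram identity holds for any quadratic form, and the term with \<open>x - y\<close> is nonnegative.
\<close>

lemma dissipation_add_le: "dissipation (x + y) \<le> 2 * dissipation x + 2 * dissipation y"
proof -
  have "dissipation (x + y) + dissipation (x - y) = 2 * dissipation x + 2 * dissipation y"
    by (simp add: dissipation_def blinfun.bilinear_simps inner_simps)
  then show ?thesis using dissipation_nonneg[of "x - y"] by linarith
qed

lemma dissipation_sum_le: "dissipation (\<Sum>i\<le>n. y i) \<le> 2 ^ n * (\<Sum>i\<le>n. dissipation (y i))"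
proof (induction n)
  case (Suc n)
  have "dissipation (\<Sum>i\<le>Suc n. y i) \<le> 2 * dissipation (\<Sum>i\<le>n. y i) + 2 * dissipation (y (Suc n))"
    using dissipation_add_le by simp
  also have "\<dots> \<le> 2 * (2 ^ n * (\<Sum>i\<le>n. dissipation (y i))) + 2 ^ Suc n * dissipation (y (Suc n))"
    using Suc dissipation_nonneg[of "y (Suc n)"] by (intro add_mono mult_right_mono) auto
  finally show ?case by (simp add: algebra_simps)
qed simp

lemma evolution_0: "evolution 0 = id_blinfun"
  by (simp add: evolution_def op_exp_0)

lemma evolution_has_vector_derivative:
  "(evolution has_vector_derivative - (C o\<^sub>L evolution t)) (at t)"
proof -
  have "evolution = (\<lambda>t. op_exp (t *\<^sub>R (- C)))"
    by (simp add: fun_eq_iff evolution_def)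
  then show ?thesis
    using op_exp_has_derivative[of "- C" t]
    by (simp only: bounded_bilinear.minus_left[OF bounded_bilinear_blinfun_compose])
qed

lemma orbit_has_vector_derivative:
  "((\<lambda>t. evolution t x) has_vector_derivative - C (evolution t x)) (at t)"
  using bounded_linear.has_vector_derivative[OF blinfun.bounded_linear_left
      evolution_has_vector_derivative]
  by (simp add: blinfun.bilinear_simps)

text \<open>
  The energy identity is stated for any solution of \<open>u' = - C u\<close>, not only for orbits of the
  exponential; applied to a difference of two solutions, it yields uniqueness and
  thereby the semigroup law.
\<close>

lemma energy_has_derivative:
  assumes "(u has_vector_derivative - C (u t)) (at t)"
  shows "((\<lambda>t. (norm (u t))\<^sup>2) has_real_derivative - 2 * dissipation (u t)) (at t)"
  using bounded_bilinear.has_vector_derivative[OF bounded_bilinear_inner assms assms]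
  by (simp add: power2_norm_eq_inner dissipation_def inner_commute
      has_real_derivative_iff_has_vector_derivative)

lemma energy_antimono:
  assumes "\<And>t. (u has_vector_derivative - C (u t)) (at t)" and "s \<le> t"
  shows "norm (u t) \<le> norm (u s)"
proof -
  have "(norm (u t))\<^sup>2 \<le> (norm (u s))\<^sup>2"
    using assms(2)
  proof (rule DERIV_nonpos_imp_nonincreasing)
    fix r
    show "\<exists>y. ((\<lambda>t. (norm (u t))\<^sup>2) has_real_derivative y) (at r) \<and> y \<le> 0"
      using energy_has_derivative[OF assms(1)[of r]] dissipation_nonneg[of "u r"] by auto
  qed
  then show ?thesis by (rule power2_le_imp_le) simp
qed

text \<open>
  Both sides solve the same initial value problem in \<open>t\<close>, and the norm of their difference is
  nonincreasing.
\<close>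

lemma evolution_add:
  assumes "0 \<le> t"
  shows "evolution (s + t) x = evolution t (evolution s x)"
proof -
  define u where "u t = evolution (s + t) x - evolution t (evolution s x)" for t
  have shift: "((\<lambda>t. evolution (s + t) x) has_vector_derivative - C (evolution (s + t) x)) (at t)"
    for t
  proof -
    have "((\<lambda>t. s + t) has_vector_derivative 1) (at t)"
      by (auto intro!: derivative_eq_intros)
    from vector_diff_chain_at[OF this orbit_has_vector_derivative] show ?thesis
      by (simp add: o_def)
  qed
  have "(u has_vector_derivative - C (u t)) (at t)" for t
    unfolding u_def
    using has_vector_derivative_diff[OF shift[of t] orbit_has_vector_derivative[of "evolution s x" t]]
    by (simp add: blinfun.diff_right)
  from energy_antimono[of u, OF this assms] have "u t = 0"
    by (simp add: u_def evolution_0)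
  then show ?thesis by (simp add: u_def)
qed

lemma norm_evolution_le: "0 \<le> t \<Longrightarrow> norm (evolution t x) \<le> norm x"
  using energy_antimono[OF orbit_has_vector_derivative, of 0 t x] by (simp add: evolution_0)

text \<open>
  Differentiability at zero in operator norm makes the approximation uniform in \<open>y\<close>; a
  strongly continuous semigroup with unbounded generator does not have this property.
\<close>

lemma generator_approx:
  assumes "0 < \<epsilon>"
  obtains d where "0 < d"
    and "\<And>h y. 0 < h \<Longrightarrow> h < d \<Longrightarrow> norm (C y - (1 / h) *\<^sub>R (y - evolution h y)) \<le> \<epsilon> * norm y"
proof -
  have compose_id: "C o\<^sub>L id_blinfun = C" by (rule blinfun_eqI) simp
  have "(evolution has_derivative (\<lambda>h. h *\<^sub>R - C)) (at 0)"
    using evolution_has_vector_derivative[of 0]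
    by (simp add: has_vector_derivative_def evolution_0 compose_id)
  then obtain d where d: "0 < d"
    "\<And>h. \<bar>h\<bar> < d \<Longrightarrow> norm (evolution h - id_blinfun - h *\<^sub>R (- C)) \<le> \<epsilon> * \<bar>h\<bar>"
    using assms unfolding has_derivative_at_alt by (auto simp: evolution_0)
  have "norm (C y - (1 / h) *\<^sub>R (y - evolution h y)) \<le> \<epsilon> * norm y" if h: "0 < h" "h < d" for h y
  proof -
    have "C y - (1 / h) *\<^sub>R (y - evolution h y)
        = (1 / h) *\<^sub>R (evolution h - id_blinfun - h *\<^sub>R (- C)) y"
      using h by (simp add: blinfun.bilinear_simps algebra_simps)
    also have "norm \<dots> = (1 / h) * norm ((evolution h - id_blinfun - h *\<^sub>R (- C)) y)"
      using h by simp
    also have "\<dots> \<le> (1 / h) * ((\<epsilon> * h) * norm y)"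
    proof (intro mult_left_mono order_trans[OF norm_blinfun] mult_right_mono)
      show "norm (evolution h - id_blinfun - h *\<^sub>R (- C)) \<le> \<epsilon> * h"
        using h d(2)[of h] by simp
    qed (use h in auto)
    finally show ?thesis using h by simp
  qed
  with d(1) show ?thesis using that by blast
qed

section \<open>Coercivity implies exponential stability\<close>

text \<open>
  The energy lost up to time \<open>t\<close>. Since \<^term>\<open>evolution t\<close> is a contraction, this is a nonnegative
  quadratic form in \<open>y\<close>.
\<close>

definition defect :: "real \<Rightarrow> 'a \<Rightarrow> real"
  where "defect t y = (norm y)\<^sup>2 - (norm (evolution t y))\<^sup>2"

lemma defect_nonneg: "0 \<le> t \<Longrightarrow> 0 \<le> defect t y"
  by (simp add: defect_def norm_evolution_le power_mono)

lemma defect_le: "defect t y \<le> (norm y)\<^sup>2"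
  by (simp add: defect_def)

lemma defect_scaleR: "defect t (r *\<^sub>R y) = r\<^sup>2 * defect t y"
  by (simp add: defect_def blinfun.scaleR_right power_mult_distrib algebra_simps)

lemma defect_parallelogram:
  "defect t (x + y) + defect t (x - y) = 2 * defect t x + 2 * defect t y"
  by (simp add: defect_def power2_norm_eq_inner blinfun.bilinear_simps inner_simps inner_commute)

lemma defect_add_le: "0 \<le> t \<Longrightarrow> defect t (x + y) \<le> 2 * defect t x + 2 * defect t y"
  using defect_parallelogram[of t x y] defect_nonneg[of t "x - y"] by linarith

lemma defect_diff_le: "0 \<le> t \<Longrightarrow> defect t (x - y) \<le> 2 * defect t x + 2 * defect t y"
  using defect_parallelogram[of t x y] defect_nonneg[of t "x + y"] by linarith

lemma defect_evolution_le:
  assumes "0 \<le> s" "0 \<le> t"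
  shows "defect t (evolution s y) \<le> defect (s + t) y"
  using norm_evolution_le[OF assms(1), of y] evolution_add[OF assms(2), of s y]
  by (simp add: defect_def power_mono)

lemma defect_mono:
  assumes "s \<le> t"
  shows "defect s y \<le> defect t y"
  using energy_antimono[OF orbit_has_vector_derivative assms, of y]
  by (simp add: defect_def power_mono)

definition asymptotically_isometric :: "(nat \<Rightarrow> 'a) \<Rightarrow> bool"
  where "asymptotically_isometric y \<longleftrightarrow>
    bounded (range y) \<and> (\<forall>t\<ge>0. (\<lambda>n. defect t (y n)) \<longlonglongrightarrow> 0)"

lemma bounded_range_obtain:
  assumes "bounded (range (y :: nat \<Rightarrow> 'a))"
  obtains K where "0 < K" "\<And>n. norm (y n) \<le> K"
  using assms by (auto simp: bounded_pos)

text \<open>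
  Write \<open>C y = (1 / h) (y - T h y) + r\<close>. The defect of the first summand is controlled by defects
  of \<open>y\<close> at the times \<open>t\<close> and \<open>h + t\<close>, which vanish asymptotically for fixed \<open>h\<close>; the defect of \<open>r\<close> is at
  most \<open>\<parallel>r\<parallel>\<^sup>2\<close>, small uniformly in the sequence by the choice of \<open>h\<close>.
\<close>

lemma asymptotically_isometric_generator:
  assumes "asymptotically_isometric y"
  shows "asymptotically_isometric (\<lambda>n. C (y n))"
  unfolding asymptotically_isometric_def
proof (intro conjI allI impI)
  have bdd: "bounded (range y)" and lim: "\<And>t. 0 \<le> t \<Longrightarrow> (\<lambda>n. defect t (y n)) \<longlonglongrightarrow> 0"
    using assms by (auto simp: asymptotically_isometric_def)
  obtain K where K: "0 < K" "\<And>n. norm (y n) \<le> K"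
    using bdd by (rule bounded_range_obtain) blast
  show "bounded (range (\<lambda>n. C (y n)))"
    using bounded_linear_image[OF bdd blinfun.bounded_linear_right[of C]] by (simp add: image_image)
  fix t :: real assume t: "0 \<le> t"
  show "(\<lambda>n. defect t (C (y n))) \<longlonglongrightarrow> 0"
  proof (rule LIMSEQ_I)
    fix e :: real assume e: "0 < e"
    \<comment> \<open>Chosen so that the remainder contributes at most \<open>e / 2\<close> to the defect.\<close>
    define \<epsilon> where "\<epsilon> = sqrt e / (2 * K)"
    have \<epsilon>: "0 < \<epsilon>" "2 * (\<epsilon> * K)\<^sup>2 = e / 2"
      using e K by (simp_all add: \<epsilon>_def power_divide)
    obtain d where d: "0 < d"
      "\<And>h y. 0 < h \<Longrightarrow> h < d \<Longrightarrow> norm (C y - (1 / h) *\<^sub>R (y - evolution h y)) \<le> \<epsilon> * norm y"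
      using generator_approx[OF \<epsilon>(1)] by blast
    define h where "h = d / 2"
    have h: "0 < h" "h < d" using d by (simp_all add: h_def)
    define b where "b n = 2 * ((1 / h)\<^sup>2 * (2 * defect t (y n) + 2 * defect (h + t) (y n)))" for n
    have "b \<longlonglongrightarrow> 2 * ((1 / h)\<^sup>2 * (2 * 0 + 2 * 0))"
      unfolding b_def using t h by (intro tendsto_intros lim) auto
    then have ev: "\<forall>\<^sub>F n in sequentially. b n < e / 2"
      using e by (intro order_tendstoD) auto
    have bound: "defect t (C (y n)) \<le> b n + e / 2" for n
    proof -
      define r where "r = C (y n) - (1 / h) *\<^sub>R (y n - evolution h (y n))"
      have "norm r \<le> \<epsilon> * K"
        using d(2)[OF h, of "y n"] mult_left_mono[OF K(2)[of n], of \<epsilon>] \<epsilon>(1)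
        unfolding r_def by linarith
      then have "defect t r \<le> (\<epsilon> * K)\<^sup>2"
        using defect_le[of t r] power_mono[of "norm r" "\<epsilon> * K" 2] by simp
      moreover have "defect t (C (y n)) \<le> 2 * defect t ((1 / h) *\<^sub>R (y n - evolution h (y n))) + 2 * defect t r"
        using defect_add_le[OF t, of "(1 / h) *\<^sub>R (y n - evolution h (y n))" r] by (simp add: r_def)
      moreover have "2 * defect t ((1 / h) *\<^sub>R (y n - evolution h (y n))) \<le> b n"
      proof -
        have "defect t (y n - evolution h (y n)) \<le> 2 * defect t (y n) + 2 * defect (h + t) (y n)"
          using defect_diff_le[OF t, of "y n" "evolution h (y n)"]
            defect_evolution_le[of h t "y n"] h t by simp
        then show ?thesis
          unfolding b_def defect_scaleR by (intro mult_left_mono) auto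
      qed
      ultimately show ?thesis using \<epsilon>(2) by linarith
    qed
    from ev have "\<forall>\<^sub>F n in sequentially. norm (defect t (C (y n)) - 0) < e"
    proof (rule eventually_mono)
      fix n assume "b n < e / 2"
      with bound[of n] defect_nonneg[OF t, of "C (y n)"] show "norm (defect t (C (y n)) - 0) < e" by simp
    qed
    then show "\<exists>no. \<forall>n\<ge>no. norm (defect t (C (y n)) - 0) < e"
      by (simp add: eventually_sequentially)
  qed
qed

text \<open>
  The energy identity over a short time, with explicit error: with \<open>w = y - T h y\<close>, expanding
  the square gives \<open>defect h y + \<parallel>w\<parallel>\<^sup>2 = 2 \<langle>w, y\<rangle>\<close>, while \<open>w / h\<close> is close to \<open>C y\<close>.
\<close>

lemma dissipation_le_defect:
  assumes "0 < h" and approx: "norm (C y - (1 / h) *\<^sub>R (y - evolution h y)) \<le> \<epsilon> * norm y"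
  shows "dissipation y \<le> defect h y / (2 * h) + (\<epsilon> + h * (norm C + \<epsilon>)\<^sup>2 / 2) * (norm y)\<^sup>2"
proof -
  define w where "w = y - evolution h y"
  define r where "r = C y - (1 / h) *\<^sub>R w"
  have r: "norm r \<le> \<epsilon> * norm y" using approx by (simp add: r_def w_def)
  have "inner r y \<le> norm r * norm y" by (rule norm_cauchy_schwarz)
  also have "\<dots> \<le> \<epsilon> * (norm y)\<^sup>2"
    using mult_right_mono[OF r, of "norm y"] by (simp add: power2_eq_square mult.assoc)
  finally have ry: "inner r y \<le> \<epsilon> * (norm y)\<^sup>2" .
  have "w = h *\<^sub>R (C y - r)" using assms(1) by (simp add: r_def)
  then have "norm w = h * norm (C y - r)" using assms(1) by simp
  also have "\<dots> \<le> h * ((norm C + \<epsilon>) * norm y)"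
    using assms(1) r norm_triangle_ineq4[of "C y" r] norm_blinfun[of C y]
    by (intro mult_left_mono) (auto simp: algebra_simps)
  finally have "(norm w)\<^sup>2 \<le> (h * ((norm C + \<epsilon>) * norm y))\<^sup>2"
    by (intro power_mono) auto
  then have "(norm w)\<^sup>2 / (2 * h) \<le> (h * ((norm C + \<epsilon>) * norm y))\<^sup>2 / (2 * h)"
    using assms(1) by (intro divide_right_mono) auto
  also have "\<dots> = h * (norm C + \<epsilon>)\<^sup>2 / 2 * (norm y)\<^sup>2"
    using assms(1) by (simp add: power_mult_distrib power2_eq_square)
  finally have ww: "(norm w)\<^sup>2 / (2 * h) \<le> h * (norm C + \<epsilon>)\<^sup>2 / 2 * (norm y)\<^sup>2" .
  have "defect h y + (norm w)\<^sup>2 = 2 * inner w y"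
    unfolding defect_def w_def power2_norm_eq_inner by (simp add: inner_simps inner_commute)
  then have "inner w y / h = defect h y / (2 * h) + (norm w)\<^sup>2 / (2 * h)"
    using assms(1) by (simp add: field_simps)
  moreover have "dissipation y = inner r y + inner w y / h"
    by (simp add: dissipation_def r_def inner_simps)
  ultimately show ?thesis using ry ww by (simp add: algebra_simps)
qed

lemma asymptotically_isometric_dissipation:
  assumes "asymptotically_isometric y"
  shows "(\<lambda>n. dissipation (y n)) \<longlonglongrightarrow> 0"
proof (rule LIMSEQ_I)
  fix e :: real assume e: "0 < e"
  have bdd: "bounded (range y)" and lim: "\<And>t. 0 \<le> t \<Longrightarrow> (\<lambda>n. defect t (y n)) \<longlonglongrightarrow> 0"
    using assms by (auto simp: asymptotically_isometric_def)
  obtain K where K: "0 < K" "\<And>n. norm (y n) \<le> K"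
    using bdd by (rule bounded_range_obtain) blast
  define \<epsilon> where "\<epsilon> = e / (4 * K\<^sup>2)"
  have \<epsilon>: "0 < \<epsilon>" "\<epsilon> * K\<^sup>2 = e / 4" using e K by (simp_all add: \<epsilon>_def)
  obtain d where d: "0 < d"
    "\<And>h y. 0 < h \<Longrightarrow> h < d \<Longrightarrow> norm (C y - (1 / h) *\<^sub>R (y - evolution h y)) \<le> \<epsilon> * norm y"
    using generator_approx[OF \<epsilon>(1)] by blast
  define c where "c = (norm C + \<epsilon>)\<^sup>2"
  have c: "0 < c" using add_nonneg_pos[OF norm_ge_zero[of C] \<epsilon>(1)] by (simp add: c_def)
  \<comment> \<open>The second bound makes the error of size \<open>h\<close> in the estimate by the defect at most \<open>\<epsilon>\<close>.\<close>
  define h where "h = min (d / 2) (\<epsilon> / c)"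
  have h: "0 < h" "h < d" "h * c \<le> \<epsilon>"
    using d \<epsilon> c by (auto simp: h_def min_def field_simps)
  have "(\<lambda>n. defect h (y n) / (2 * h)) \<longlonglongrightarrow> 0 / (2 * h)"
    using h by (intro tendsto_intros lim) auto
  then have ev: "\<forall>\<^sub>F n in sequentially. defect h (y n) / (2 * h) < e / 2"
    using e by (intro order_tendstoD) auto
  have bound: "dissipation (y n) \<le> defect h (y n) / (2 * h) + e / 2" for n
  proof -
    have "(\<epsilon> + h * c / 2) * (norm (y n))\<^sup>2 \<le> (2 * \<epsilon>) * K\<^sup>2"
      using h \<epsilon> K by (intro mult_mono power_mono) auto
    then show ?thesis
      using dissipation_le_defect[OF h(1) d(2)[OF h(1,2)], of "y n"] \<epsilon>(2)
      by (simp add: c_def)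
  qed
  from ev have "\<forall>\<^sub>F n in sequentially. norm (dissipation (y n) - 0) < e"
  proof (rule eventually_mono)
    fix n assume "defect h (y n) / (2 * h) < e / 2"
    with bound[of n] dissipation_nonneg[of "y n"]
    show "norm (dissipation (y n) - 0) < e" by simp
  qed
  then show "\<exists>no. \<forall>n\<ge>no. norm (dissipation (y n) - 0) < e"
    by (simp add: eventually_sequentially)
qed

lemma strict_contraction_if_coercive:
  assumes "0 < \<kappa>"
    and coercive: "\<And>x. \<kappa> * (norm x)\<^sup>2 \<le> (\<Sum>j\<le>m. dissipation (op_power C j x))"
  obtains t c where "0 < t" "0 < c" "c < 1" "\<And>x. norm (evolution t x) \<le> c * norm x"
proof -
  \<comment> \<open>The times must tend to infinity, so that the sequence found below is asymptotically
    isometric at every fixed time. The shift keeps the contraction time positive, as the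
    decay rate requires.\<close>
  have "\<exists>n::nat. \<forall>x. (norm (evolution (Suc n) x))\<^sup>2 \<le> (1 - 1 / (real (Suc n) + 1)) * (norm x)\<^sup>2"
  proof (rule ccontr)
    assume "\<not> ?thesis"
    then obtain x where x:
      "\<And>n. (1 - 1 / (real (Suc n) + 1)) * (norm (x n))\<^sup>2 < (norm (evolution (Suc n) (x n)))\<^sup>2"
      by (metis not_le)
    have nz: "x n \<noteq> 0" for n using x[of n] by (auto simp: blinfun.bilinear_simps)
    define y where "y n = (1 / norm (x n)) *\<^sub>R x n" for n
    have norm_y: "norm (y n) = 1" for n using nz by (simp add: y_def)
    have small: "defect (Suc n) (y n) \<le> 1 / Suc n" for n
    proof -
      have "defect (Suc n) (x n) \<le> (1 / (real (Suc n) + 1)) * (norm (x n))\<^sup>2"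
        using x[of n] by (simp add: defect_def algebra_simps)
      then have "defect (Suc n) (y n) \<le> 1 / (real (Suc n) + 1)"
        using nz[of n] by (simp add: y_def defect_scaleR power_divide field_simps)
      also have "\<dots> \<le> 1 / Suc n" by (intro divide_left_mono) auto
      finally show ?thesis .
    qed
    have y: "asymptotically_isometric y"
      unfolding asymptotically_isometric_def
    proof (intro conjI allI impI)
      show "bounded (range y)" by (rule boundedI[of _ 1]) (auto simp: norm_y)
      fix t :: real assume t: "0 \<le> t"
      show "(\<lambda>n. defect t (y n)) \<longlonglongrightarrow> 0"
      proof (rule tendsto_sandwich)
        show "\<forall>\<^sub>F n in sequentially. 0 \<le> defect t (y n)"
          using defect_nonneg[OF t] by simp
        have "defect t (y n) \<le> 1 / Suc n" if "nat \<lceil>t\<rceil> \<le> n" for n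
          using that by (intro order_trans[OF defect_mono small]) linarith
        then show "\<forall>\<^sub>F n in sequentially. defect t (y n) \<le> 1 / Suc n"
          unfolding eventually_sequentially by blast
      qed (intro tendsto_const LIMSEQ_Suc[OF lim_1_over_n])+
    qed
    have "asymptotically_isometric (\<lambda>n. op_power C j (y n))" for j
      by (induction j) (use y asymptotically_isometric_generator in auto)
    then have "(\<lambda>n. \<Sum>j\<le>m. dissipation (op_power C j (y n))) \<longlonglongrightarrow> (\<Sum>j\<le>m. 0)"
      by (intro tendsto_sum asymptotically_isometric_dissipation)
    moreover have "\<kappa> \<le> (\<Sum>j\<le>m. dissipation (op_power C j (y n)))" for n
      using coercive[of "y n"] by (simp add: norm_y)
    ultimately have "\<kappa> \<le> (\<Sum>j\<le>m. 0)"
      by (intro LIMSEQ_le_const) auto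
    with \<open>0 < \<kappa>\<close> show False by simp
  qed
  then obtain n :: nat where
    n: "\<And>x. (norm (evolution (Suc n) x))\<^sup>2 \<le> (1 - 1 / (real (Suc n) + 1)) * (norm x)\<^sup>2" by blast
  define c where "c = sqrt (1 - 1 / (real (Suc n) + 1))"
  have pos: "0 < 1 - 1 / (real (Suc n) + 1)" by (simp add: field_simps)
  have "norm (evolution (Suc n) x) \<le> c * norm x" for x
    using real_sqrt_le_mono[OF n[of x]] by (simp add: c_def real_sqrt_mult)
  moreover have "0 < c" "c < 1" using pos by (auto simp: c_def real_sqrt_lt_1_iff)
  ultimately show ?thesis by (intro that[of "Suc n" c]) auto
qed

text \<open>
  The decay rate is the one of the geometric sequence \<open>c\<^sup>k\<close> sampled at times \<open>k * t\<close>; the factor \<open>1 / c\<close>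
  pays for the incomplete last period.
\<close>

lemma exponentially_stable_if_strict_contraction:
  assumes "0 < t" "0 < c" "c < 1" and contr: "\<And>x. norm (evolution t x) \<le> c * norm x"
  shows "uniformly_exponentially_stable evolution"
proof -
  have iter: "norm (evolution (real k * t) x) \<le> c ^ k * norm x" for k x
  proof (induction k)
    case (Suc k)
    have "evolution (real (Suc k) * t) x = evolution t (evolution (real k * t) x)"
      using evolution_add[of t "real k * t" x] assms(1) by (simp add: algebra_simps)
    also have "norm \<dots> \<le> c * (c ^ k * norm x)"
      using contr assms(2) by (intro order_trans[OF contr] mult_left_mono Suc) auto
    finally show ?case by simp
  qed (simp add: evolution_0)
  define \<omega> where "\<omega> = - ln c / t"
  have "0 < \<omega>" using assms by (simp add: \<omega>_def field_simps)
  moreover have "norm (evolution s) \<le> (1 / c) * exp (- \<omega> * s)" if s: "0 \<le> s" for s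
  proof (rule norm_blinfun_bound)
    show "0 \<le> (1 / c) * exp (- \<omega> * s)" using assms(2) by simp
    fix x
    define k where "k = nat \<lfloor>s / t\<rfloor>"
    have k: "real k * t \<le> s" "s < (real k + 1) * t"
    proof -
      have "real k = of_int \<lfloor>s / t\<rfloor>" using s assms(1) by (simp add: k_def)
      then have "real k \<le> s / t" "s / t < real k + 1" by linarith+
      then show "real k * t \<le> s" "s < (real k + 1) * t" using assms(1) by (simp_all add: field_simps)
    qed
    have "evolution s x = evolution (s - real k * t) (evolution (real k * t) x)"
      using evolution_add[of "s - real k * t" "real k * t" x] k by simp
    also have "norm \<dots> \<le> norm (evolution (real k * t) x)"
      using k by (intro norm_evolution_le) simp
    also have "\<dots> \<le> c ^ k * norm x" by (rule iter)
    also have "\<dots> \<le> ((1 / c) * exp (- \<omega> * s)) * norm x"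
    proof (intro mult_right_mono)
      have "real (Suc k) * ln c \<le> - \<omega> * s"
      proof -
        have "- ln c * s \<le> - ln c * ((real k + 1) * t)"
          using assms k by (intro mult_left_mono) auto
        then show ?thesis using assms(1) by (simp add: \<omega>_def field_simps)
      qed
      then have "exp (real (Suc k) * ln c) \<le> exp (- \<omega> * s)" by simp
      also have "exp (real (Suc k) * ln c) = c ^ Suc k"
        using assms(2) by (simp only: exp_of_nat_mult exp_ln)
      finally show "c ^ k \<le> (1 / c) * exp (- \<omega> * s)"
        using assms(2) by (simp add: field_simps)
    qed simp
    finally show "norm (evolution s x) \<le> (1 / c) * exp (- \<omega> * s) * norm x" .
  qed
  ultimately show ?thesis unfolding uniformly_exponentially_stable_def by blast
qed

section \<open>Exponential stability implies coercivity\<close>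

lemma exponentially_stable_halves:
  assumes "uniformly_exponentially_stable evolution"
  obtains t where "1 \<le> t" "\<And>x. norm (evolution t x) \<le> 1 / 2 * norm x"
proof -
  obtain M \<omega> where \<omega>: "0 < \<omega>" and M: "\<And>t. 0 \<le> t \<Longrightarrow> norm (evolution t) \<le> M * exp (- \<omega> * t)"
    using assms unfolding uniformly_exponentially_stable_def by blast
  \<comment> \<open>By \<open>exp x \<ge> 1 + x\<close>, this time is long enough; being at least 1, its powers are nondecreasing
    in the exponent, which is convenient later.\<close>
  define t where "t = max 1 (2 * \<bar>M\<bar> / \<omega>)"
  have t: "1 \<le> t" "2 * \<bar>M\<bar> \<le> \<omega> * t"
    using \<omega> by (auto simp: t_def max_def field_simps)
  have "2 * M \<le> exp (\<omega> * t)" using t(2) exp_ge_add_one_self[of "\<omega> * t"] by linarith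
  then have "M * exp (- \<omega> * t) \<le> 1 / 2" by (simp add: exp_minus field_simps)
  with M[of t] t(1) have T: "norm (evolution t) \<le> 1 / 2" by linarith
  have "norm (evolution t x) \<le> 1 / 2 * norm x" for x
    using norm_blinfun[of "evolution t" x] mult_right_mono[OF T, of "norm x"] by simp
  with t(1) show ?thesis using that by blast
qed

text \<open>
  The mean value theorem for the energy. The time \<open>s\<close> depends on \<open>x\<close>, which is harmless because the Taylor
  approximation below is uniform in time.
\<close>

lemma dissipation_on_orbit:
  assumes "0 < t" "norm (evolution t x) \<le> 1 / 2 * norm x"
  obtains s where "0 < s" "s < t" "(norm x)\<^sup>2 \<le> 4 * t * dissipation (evolution s x)"
proof -
  obtain s where s: "0 < s" "s < t"
    "(norm (evolution t x))\<^sup>2 - (norm (evolution 0 x))\<^sup>2 = (t - 0) * (- 2 * dissipation (evolution s x))"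
    using MVT2[OF assms(1), of "\<lambda>t. (norm (evolution t x))\<^sup>2" "\<lambda>s. - 2 * dissipation (evolution s x)"]
      energy_has_derivative[OF orbit_has_vector_derivative] by blast
  have "(norm (evolution t x))\<^sup>2 \<le> (1 / 2 * norm x)\<^sup>2"
    using assms(2) by (intro power_mono) auto
  then have "(norm (evolution t x))\<^sup>2 \<le> (norm x)\<^sup>2 / 4" by (simp add: power_divide)
  moreover have "(norm x)\<^sup>2 - (norm (evolution t x))\<^sup>2 = 2 * (t * dissipation (evolution s x))"
    using s(3) by (simp add: evolution_0 algebra_simps)
  ultimately have "(norm x)\<^sup>2 \<le> 4 * (t * dissipation (evolution s x))"
    using zero_le_power2[of "norm x"] by linarith
  with s(1,2) show ?thesis by (intro that[of s]) (auto simp: mult.assoc)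
qed

lemma evolution_taylor:
  assumes "0 < \<epsilon>"
  obtains m where "\<And>s x. \<bar>s\<bar> \<le> t \<Longrightarrow>
    norm (evolution s x - (\<Sum>i\<le>m. ((- s) ^ i / fact i) *\<^sub>R op_power C i x)) \<le> \<epsilon> * norm x"
proof -
  have pow: "op_power (- C) i = (- 1) ^ i *\<^sub>R op_power C i" for i
    using op_power_scaleR[of "- 1" C i] by simp
  obtain N where N: "\<And>n s. n \<ge> N \<Longrightarrow> s \<in> {-t..t} \<Longrightarrow>
      dist (\<Sum>i<n. (s ^ i / fact i) *\<^sub>R op_power (- C) i) (op_exp (s *\<^sub>R - C)) < \<epsilon>"
    using uniform_limitD[OF op_exp_uniform_limit[where A = "- C" and R = t] assms]
    unfolding eventually_sequentially by blast
  have "norm (evolution s x - (\<Sum>i\<le>N. ((- s) ^ i / fact i) *\<^sub>R op_power C i x)) \<le> \<epsilon> * norm x"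
    if "\<bar>s\<bar> \<le> t" for s x
  proof -
    define P where "P = (\<Sum>i<Suc N. (s ^ i / fact i) *\<^sub>R op_power (- C) i)"
    have "norm (evolution s - P) \<le> \<epsilon>"
      using N[of "Suc N" s] that by (simp add: P_def evolution_def dist_norm norm_minus_commute abs_le_iff)
    then have "norm ((evolution s - P) x) \<le> \<epsilon> * norm x"
      by (intro order_trans[OF norm_blinfun] mult_right_mono) auto
    moreover have "P x = (\<Sum>i\<le>N. ((- s) ^ i / fact i) *\<^sub>R op_power C i x)"
      unfolding P_def lessThan_Suc_atMost blinfun.sum_left
      by (intro sum.cong refl) (simp add: pow blinfun.scaleR_left power_minus[of s])
    ultimately show ?thesis by (simp add: blinfun.diff_left)
  qed
  then show ?thesis using that by blast
qed

text \<open>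
  For some \<open>s\<close> the dissipation of \<open>T s x\<close> is at least \<open>\<parallel>x\<parallel>\<^sup>2 / (4 t)\<close>. When \<open>T s x\<close> is split into its
  Taylor polynomial \<open>P\<close> and a remainder, the remainder accounts for at most half of this, and the
  other half is left to the dissipation of \<open>P\<close>.
\<close>

lemma coercive_if_exponentially_stable:
  assumes "uniformly_exponentially_stable evolution"
  obtains m \<kappa> where "0 < \<kappa>"
    and "\<And>x. \<kappa> * (norm x)\<^sup>2 \<le> (\<Sum>j\<le>m. dissipation (op_power C j x))"
proof -
  obtain t where t: "1 \<le> t" "\<And>x. norm (evolution t x) \<le> 1 / 2 * norm x"
    using exponentially_stable_halves[OF assms] by blast
  \<comment> \<open>Chosen to make \<open>2 * \<parallel>C\<parallel> * \<epsilon>\<^sup>2 \<le> 1 / (8 * t)\<close>; the summand 1 only avoids a division by zero.\<close>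
  define \<epsilon> where "\<epsilon> = sqrt (1 / (16 * t * (norm C + 1)))"
  have \<epsilon>: "0 < \<epsilon>" "\<epsilon>\<^sup>2 = 1 / (16 * t * (norm C + 1))"
    using t(1) norm_ge_zero[of C] by (simp_all add: \<epsilon>_def add_nonneg_pos)
  have "norm C * \<epsilon>\<^sup>2 \<le> (norm C + 1) * \<epsilon>\<^sup>2" by (intro mult_right_mono) auto
  also have "\<dots> = 1 / (16 * t)"
    using norm_ge_zero[of C] unfolding \<epsilon>(2) by (simp add: add_nonneg_eq_0_iff)
  finally have C\<epsilon>: "norm C * \<epsilon>\<^sup>2 \<le> 1 / (16 * t)" .
  obtain m where m: "\<And>s x. \<bar>s\<bar> \<le> t \<Longrightarrow>
      norm (evolution s x - (\<Sum>i\<le>m. ((- s) ^ i / fact i) *\<^sub>R op_power C i x)) \<le> \<epsilon> * norm x"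
    using evolution_taylor[OF \<epsilon>(1)] by blast
  \<comment> \<open>The first factor comes from splitting the dissipation of a sum of \<open>m + 1\<close> vectors; the second
    bounds the squares of the Taylor coefficients.\<close>
  define L where "L = 2 ^ m * (t ^ m)\<^sup>2"
  have L: "0 < L" using t(1) by (simp add: L_def)
  have "1 / (16 * t * L) * (norm x)\<^sup>2 \<le> (\<Sum>j\<le>m. dissipation (op_power C j x))" for x
  proof -
    obtain s where s: "0 < s" "s < t" "(norm x)\<^sup>2 \<le> 4 * t * dissipation (evolution s x)"
      by (rule dissipation_on_orbit[OF _ t(2)]) (use t(1) in linarith)
    define P where "P = (\<Sum>i\<le>m. ((- s) ^ i / fact i) *\<^sub>R op_power C i x)"
    define r where "r = evolution s x - P"
    have "norm r \<le> \<epsilon> * norm x" using m[of s x] s by (simp add: r_def P_def)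
    then have "(norm r)\<^sup>2 \<le> (\<epsilon> * norm x)\<^sup>2" by (intro power_mono) auto
    then have "norm C * (norm r)\<^sup>2 \<le> norm C * (\<epsilon>\<^sup>2 * (norm x)\<^sup>2)"
      by (intro mult_left_mono) (auto simp: power_mult_distrib)
    also have "\<dots> \<le> 1 / (16 * t) * (norm x)\<^sup>2"
      using mult_right_mono[OF C\<epsilon>, of "(norm x)\<^sup>2"] by (simp add: mult.assoc)
    finally have qr: "dissipation r \<le> 1 / (16 * t) * (norm x)\<^sup>2"
      using dissipation_le[of r] by linarith
    have "dissipation P \<le> 2 ^ m * (\<Sum>i\<le>m. dissipation (((- s) ^ i / fact i) *\<^sub>R op_power C i x))"
      unfolding P_def by (rule dissipation_sum_le)
    also have "\<dots> \<le> 2 ^ m * (\<Sum>i\<le>m. (t ^ m)\<^sup>2 * dissipation (op_power C i x))"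
    proof (intro mult_left_mono sum_mono)
      fix i assume "i \<in> {..m}"
      have "\<bar>(- s) ^ i / fact i\<bar> = s ^ i / fact i" using s by (simp add: power_abs)
      also have "\<dots> \<le> s ^ i" using s by (simp add: divide_le_eq mult_le_cancel_left1 fact_ge_1)
      also have "\<dots> \<le> t ^ i" using s by (intro power_mono) auto
      also have "\<dots> \<le> t ^ m" using t(1) \<open>i \<in> {..m}\<close> by (intro power_increasing) auto
      finally have "((- s) ^ i / fact i)\<^sup>2 \<le> (t ^ m)\<^sup>2"
        by (simp add: abs_le_square_iff[symmetric])
      then show "dissipation (((- s) ^ i / fact i) *\<^sub>R op_power C i x)
          \<le> (t ^ m)\<^sup>2 * dissipation (op_power C i x)"
        unfolding dissipation_scaleR by (intro mult_right_mono dissipation_nonneg)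
    qed simp
    also have "\<dots> = L * (\<Sum>j\<le>m. dissipation (op_power C j x))"
      by (simp add: L_def mult.assoc flip: sum_distrib_left)
    finally have qP: "dissipation P \<le> L * (\<Sum>j\<le>m. dissipation (op_power C j x))" .
    have "dissipation (evolution s x) \<le> 2 * dissipation P + 2 * dissipation r"
      using dissipation_add_le[of P r] by (simp add: r_def)
    moreover have "(norm x)\<^sup>2 / (4 * t) \<le> dissipation (evolution s x)"
      using s(3) t(1) by (simp add: field_simps)
    ultimately have "(norm x)\<^sup>2 / (16 * t) \<le> L * (\<Sum>j\<le>m. dissipation (op_power C j x))"
      using qr qP by simp
    then show ?thesis using L t(1) by (simp add: field_simps)
  qed
  then show ?thesis using L t(1) by (intro that[of "1 / (16 * t * L)" m]) auto
qed

theorem exponentially_stable_iff_coercive: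
  "uniformly_exponentially_stable evolution \<longleftrightarrow>
    (\<exists>m. \<exists>\<kappa>>0. \<forall>x. \<kappa> * (norm x)\<^sup>2 \<le> (\<Sum>j\<le>m. dissipation (op_power C j x)))"
proof
  assume "uniformly_exponentially_stable evolution"
  then show "\<exists>m. \<exists>\<kappa>>0. \<forall>x. \<kappa> * (norm x)\<^sup>2 \<le> (\<Sum>j\<le>m. dissipation (op_power C j x))"
    by (rule coercive_if_exponentially_stable) blast
next
  assume "\<exists>m. \<exists>\<kappa>>0. \<forall>x. \<kappa> * (norm x)\<^sup>2 \<le> (\<Sum>j\<le>m. dissipation (op_power C j x))"
  then obtain m \<kappa> where "0 < \<kappa>"
    and "\<And>x. \<kappa> * (norm x)\<^sup>2 \<le> (\<Sum>j\<le>m. dissipation (op_power C j x))"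
    by blast
  then obtain t c where "0 < t" "0 < c" "c < 1" "\<And>x. norm (evolution t x) \<le> c * norm x"
    by (rule strict_contraction_if_coercive) blast
  then show "uniformly_exponentially_stable evolution"
    by (rule exponentially_stable_if_strict_contraction)
qed

end

theorem theorem4p6:
  fixes C :: "'a::chilbert_space \<Rightarrow>\<^sub>L 'a"
  assumes "separable_space (euclidean :: 'a topology)"
    and "clinear_op C"
    and "accretive C"
  shows "(hypocoercive C \<longleftrightarrow> (\<exists>m. has_hypocoercivity_index C m)) \<and>
    (hypocoercive C \<longleftrightarrow>
      (\<exists>m. \<exists>\<kappa>>0. loewner_le (\<kappa> *\<^sub>R id_blinfun)
        (\<Sum>j\<le>m. op_power (op_adjoint C) j o\<^sub>L hermitian_part C o\<^sub>L op_power C j)))"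
proof -
  interpret accretive_operator C
    using assms(3) by unfold_locales (simp add: accretive_def inner_eq_Re_cinner)
  define P where "P m \<longleftrightarrow> (\<exists>\<kappa>>0. loewner_le (\<kappa> *\<^sub>R id_blinfun) (hypocoercivity_sum C m))" for m
  have "hypocoercive C \<longleftrightarrow> uniformly_exponentially_stable evolution"
    by (simp add: hypocoercive_def evolution_def[abs_def])
  also have "\<dots> \<longleftrightarrow> (\<exists>m. P m)"
    unfolding exponentially_stable_iff_coercive P_def
      loewner_le_hypocoercivity_sum_iff[OF assms(2)] dissipation_def ..
  finally have main: "hypocoercive C \<longleftrightarrow> (\<exists>m. P m)" .
  \<comment> \<open>An index is a least admissible \<open>m\<close>, which exists as soon as some admissible \<open>m\<close> does.\<close>
  have "has_hypocoercivity_index C m \<longleftrightarrow> P m \<and> (\<forall>k. P k \<longrightarrow> m \<le> k)" for m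
    by (simp add: has_hypocoercivity_index_def P_def)
  then have "(\<exists>m. has_hypocoercivity_index C m) \<longleftrightarrow> (\<exists>m. P m)"
    by (metis LeastI Least_le)
  with main show ?thesis
    unfolding P_def hypocoercivity_sum_def by blast
qed

end
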